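(* In the viscoelastic setting of the context, let $\mathbf{n}$ be a unit vector and suppose a unit vector $\mathbf{f}\in\mathbb{R}^d$, independent of $p$, is an eigenvector of $\mathbf{K}_\mathbf{n}(p)$ for every $p>0$. Then the corresponding eigenvalue $\kappa(p)=\mathbf{f}^\top\mathbf{K}_\mathbf{n}(p)\mathbf{f}$, $p\ge0$, is a (scalar) complete Bernstein function.
   Context: A scalar complete Bernstein function is a function $f:[0,\infty)\to[0,\infty)$, right-continuous at $0$, whose restriction to $(0,\infty)$ extends holomorphically to $\mathbb{C}\setminus\,]-\infty,0]$ with $\Im z\,\Im f(z)\ge0$ there. Viscoelastic setting: fix an integer $d\ge1$ and $\rho>0$. Let $S$ be the space of real symmetric $d\times d$ matrices with $\langle\mathbf{E},\mathbf{C}\rangle=\sum_{ij}E_{ij}C_{ij}$, and $W$ the space of linear maps of $S$ symmetric for this scalar product; in coordinates $\mathsf{X}\in W$ is an array $X_{ijkl}$. Let $\nu\neq0$ be a positive Radon measure on $[0,\infty)$ with $\nu([0,\infty))<\infty$, and $\mathsf{H}:[0,\infty)\to W$ $\nu$-measurable with $\mathsf{H}(r)$ positive semi-definite and of norm $\le1$ for $\nu$-a.e. $r$. Put $\mathsf{G}^\infty:=\nu(\{0\})\mathsf{H}(0)$. For $p\in\mathbb{C}\setminus\,]-\infty,0]$, $\mathsf{Q}(p):=p\int_{[0,\infty)}(p+r)^{-1}\mathsf{H}(r)\,\nu(\mathrm{d}r)$. For a unit vector $\mathbf{n}\in\mathbb{R}^d$ and $\mathsf{X}\in W$ let $\mathsf{X}_\mathbf{n}$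 be the $d\times d$ matrix $(\mathsf{X}_\mathbf{n})_{ik}=\sum_{j,l}X_{ijkl}n_jn_l$; this defines $\mathbf{Q}_\mathbf{n}(p)$, $\mathsf{G}^\infty_\mathbf{n}$. Standing assumption: $\mathsf{G}^\infty_\mathbf{n}$ is positive definite for every unit $\mathbf{n}$. Define $\mathbf{K}_\mathbf{n}(p):=\rho^{1/2}\,p\,\mathbf{Q}_\mathbf{n}(p)^{-1/2}$ for $p\in\mathbb{C}\setminus\,]-\infty,0]$, with $\mathbf{Q}_\mathbf{n}(p)^{1/2}$ the principal square root (eigenvalues in the open right half-plane), and $\mathbf{K}_\mathbf{n}(0):=0$. *)

theory Defs
  imports "HOL-Analysis.Analysis"
begin

definition complete_bernstein :: "(real \<Rightarrow> real) \<Rightarrow> bool" where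
  "complete_bernstein f \<longleftrightarrow>
     (\<forall>x\<ge>0. f x \<ge> 0) \<and>
     continuous (at_right 0) f \<and>
     (\<exists>F. F holomorphic_on (- (complex_of_real ` {..0})) \<and>
          (\<forall>x>0. F (complex_of_real x) = complex_of_real (f x)) \<and>
          (\<forall>z \<in> - (complex_of_real ` {..0}). Im z * Im (F z) \<ge> 0))"

definition symm_mat :: "real^'d^'d \<Rightarrow> bool" where
  "symm_mat E \<longleftrightarrow> (\<forall>i j. E$i$j = E$j$i)"

definition frob :: "real^'d^'d \<Rightarrow> real^'d^'d \<Rightarrow> real" where
  "frob E C = (\<Sum>i\<in>UNIV. \<Sum>j\<in>UNIV. E$i$j * C$i$j)"

definition app4 :: "real^'d^'d^'d^'d \<Rightarrow> real^'d^'d \<Rightarrow> real^'d^'d" where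
  "app4 X E = (\<chi> i j. \<Sum>k\<in>UNIV. \<Sum>l\<in>UNIV. X$i$j$k$l * E$k$l)"

text \<open>Elements of W in coordinates: linear maps of S (minor symmetries) which are
  symmetric w.r.t. the Frobenius product (major symmetry).\<close>
definition in_W :: "real^'d^'d^'d^'d \<Rightarrow> bool" where
  "in_W X \<longleftrightarrow> (\<forall>i j k l. X$i$j$k$l = X$j$i$k$l \<and> X$i$j$k$l = X$i$j$l$k \<and>
                             X$i$j$k$l = X$k$l$i$j)"

definition W_psd :: "real^'d^'d^'d^'d \<Rightarrow> bool" where
  "W_psd X \<longleftrightarrow> (\<forall>E. symm_mat E \<longrightarrow> frob E (app4 X E) \<ge> 0)"

definition W_norm_le1 :: "real^'d^'d^'d^'d \<Rightarrow> bool" where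
  "W_norm_le1 X \<longleftrightarrow> (\<forall>E. symm_mat E \<longrightarrow> frob (app4 X E) (app4 X E) \<le> frob E E)"

definition contract :: "('a::real_algebra_1)^'d^'d^'d^'d \<Rightarrow> real^'d \<Rightarrow> 'a^'d^'d" where
  "contract X n = (\<chi> i k. \<Sum>j\<in>UNIV. \<Sum>l\<in>UNIV. of_real (n$j * n$l) * X$i$j$k$l)"

definition Ginf :: "real measure \<Rightarrow> (real \<Rightarrow> real^'d^'d^'d^'d) \<Rightarrow> real^'d^'d^'d^'d" where
  "Ginf M H = measure M {0} *\<^sub>R H 0"

text \<open>Q(p) = p int (p+r)^{-1} H(r) nu(dr), componentwise (nu-measurability is
  with respect to the completion of nu).\<close>
definition Qfun :: "real measure \<Rightarrow> (real \<Rightarrow> real^'d^'d^'d^'d) \<Rightarrow> complex \<Rightarrow> complex^'d^'d^'d^'d" where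
  "Qfun M H p = (\<chi> i j k l. p * (\<integral>r. complex_of_real (H r $i$j$k$l) / (p + complex_of_real r)
                                     \<partial>(completion M)))"

definition real_pos_def_mat :: "real^'d^'d \<Rightarrow> bool" where
  "real_pos_def_mat G \<longleftrightarrow> (\<forall>x. x \<noteq> 0 \<longrightarrow> x \<bullet> (G *v x) > 0)"

definition is_eigenvalue :: "complex^'d^'d \<Rightarrow> complex \<Rightarrow> bool" where
  "is_eigenvalue A c \<longleftrightarrow> (\<exists>v. v \<noteq> 0 \<and> A *v v = c *s v)"

definition principal_sqrtm :: "complex^'d^'d \<Rightarrow> complex^'d^'d" where
  "principal_sqrtm A = (THE S. S ** S = A \<and> (\<forall>c. is_eigenvalue S c \<longrightarrow> Re c > 0))"

definition Kfun :: "real \<Rightarrow> real measure \<Rightarrow> (real \<Rightarrow> real^'d^'d^'d^'d) \<Rightarrow> real^'d \<Rightarrow> complex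
                    \<Rightarrow> complex^'d^'d" where
  "Kfun \<rho> M H n p = (if p = 0 then 0 else
      (\<chi> i k. complex_of_real (sqrt \<rho>) * p *
               matrix_inv (principal_sqrtm (contract (Qfun M H p) n)) $ i $ k))"

definition cvec :: "real^'d \<Rightarrow> complex^'d" where
  "cvec f = (\<chi> i. complex_of_real (f$i))"

end

(* The eigenvector equation forces kappa(p) = sqrt(rho) p / sqrt(lambda(p)) for p > 0, where
   lambda(p) = f . Q_n(p) f = p * integral of h(r) / (p + r) nu(dr) and h(r) = f . H(r)_n f >= 0.
   Thus lambda extends to z m(z) with m a Stieltjes transform. The atom of h nu at 0, positive by
   the standing assumption, keeps lambda away from the cut and makes Im z Im m(z) < 0 strict.
   In the upper half-plane Im lambda >= 0 and Im m < 0 place arg lambda(z) in [0, arg z), hence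
   z / sqrt(lambda(z)) has nonnegative imaginary part. *)
theory Submission
  imports Defs
begin

text \<open>Matrices enter only at p > 0, where Q_n(p) is real symmetric positive definite. The
  extension to complex z is built from the scalar lambda alone, so no square root of a complex
  Q_n(z) is ever studied. The matrix side has to show that the principal square root, a definite
  description, exists and is unique at these real points; the condition on its spectrum then selects
  the positive root of lambda(p). The atom of h nu also settles the limit p -> 0: lambda(p) is
  bounded below by its mass for all p > 0, so kappa(p) = O(p). All integrals are taken over the
  completion of the measure because H is only nu-measurable.\<close>

abbreviation cut_plane :: "complex set" where
  "cut_plane \<equiv> - (complex_of_real ` {..0})"

lemma mem_cut_plane_iff: "z \<in> cut_plane \<longleftrightarrow> (Im z = 0 \<longrightarrow> Re z > 0)"
proof -
  have "z \<in> complex_of_real ` {..0} \<longleftrightarrow> Im z = 0 \<and> Re z \<le> 0"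
    by (auto simp: complex_eq_iff intro!: image_eqI[where x = "Re z"])
  then show ?thesis by auto
qed

lemma cut_plane_eq_nonpos_Reals: "cut_plane = - \<real>\<^sub>\<le>\<^sub>0"
proof -
  have "z \<in> cut_plane \<longleftrightarrow> z \<in> - \<real>\<^sub>\<le>\<^sub>0" for z
    unfolding mem_cut_plane_iff by (auto simp: complex_nonpos_Reals_iff)
  then show ?thesis by blast
qed

lemma open_cut_plane: "open cut_plane"
  unfolding cut_plane_eq_nonpos_Reals by (simp add: open_Compl)

text \<open>The points -r with r \<ge> 0 fill the removed half-line, so a ball around z inside the
  cut plane bounds the distance to all of them at once; half its radius leaves room for w. This
  makes the kernels 1/(w + r) bounded uniformly in r and in w near z.\<close>

lemma cut_plane_uniformly_away:
  assumes "z \<in> cut_plane"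
  obtains d where "d > 0"
    "\<And>w r. norm (w - z) < d \<Longrightarrow> r \<ge> 0 \<Longrightarrow> d \<le> norm (w + complex_of_real r)"
proof -
  obtain e where e: "e > 0" "ball z e \<subseteq> cut_plane"
    using open_cut_plane assms openE by blast
  show thesis
  proof (rule that[of "e/2"])
    fix w :: complex and r :: real
    assume w: "norm (w - z) < e/2" and r: "r \<ge> 0"
    have "complex_of_real (- r) \<notin> cut_plane" using r by auto
    then have "complex_of_real (- r) \<notin> ball z e" using e(2) by blast
    then have "norm (z + complex_of_real r) \<ge> e"
      by (simp add: dist_norm)
    moreover have "norm (z + complex_of_real r) \<le> norm (w + complex_of_real r) + norm (w - z)"
      using norm_triangle_ineq4[of "w + complex_of_real r" "w - z"] by (simp add: add.commute)
    ultimately show "e/2 \<le> norm (w + complex_of_real r)" using w by linarith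
  qed (use e in auto)
qed

section \<open>Stieltjes transforms of bounded densities\<close>

text \<open>\<open>N\<close> will be a completed measure on the whole line, with more measurable
  sets than the Borel ones; hence measurability of the identity is a separate hypothesis, and
  support, like boundedness, is stated almost everywhere.\<close>

locale stieltjes_density = finite_measure N for N :: "real measure" +
  fixes h :: "real \<Rightarrow> real" and C :: real
  assumes id_meas [measurable]: "(\<lambda>r. r) \<in> borel_measurable N"
    and h_meas [measurable]: "h \<in> borel_measurable N"
    and r_nonneg: "AE r in N. 0 \<le> r"
    and h_bound: "AE r in N. \<bar>h r\<bar> \<le> C"
begin

definition stieltjes :: "complex \<Rightarrow> complex" where
  "stieltjes z = (\<integral>r. complex_of_real (h r) / (z + complex_of_real r) \<partial>N)"

lemma integrable_bounded_weight:
  fixes \<phi> :: "real \<Rightarrow> 'b::{banach,second_countable_topology,real_normed_algebra_1}"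
  assumes [measurable]: "\<phi> \<in> borel_measurable N" and "\<And>r. r \<ge> 0 \<Longrightarrow> norm (\<phi> r) \<le> K"
  shows "integrable N (\<lambda>r. of_real (h r) * \<phi> r)"
proof (rule integrable_const_bound)
  show "AE r in N. norm (of_real (h r) * \<phi> r) \<le> C * K"
    using r_nonneg h_bound
  proof eventually_elim
    fix r assume r: "0 \<le> r" "\<bar>h r\<bar> \<le> C"
    have "norm (of_real (h r) * \<phi> r) \<le> \<bar>h r\<bar> * norm (\<phi> r)"
      using norm_mult_ineq[of "of_real (h r)" "\<phi> r"] by simp
    also have "\<dots> \<le> C * K"
      using r assms(2) by (intro mult_mono) auto
    finally show "norm (of_real (h r) * \<phi> r) \<le> C * K" .
  qed
  show "(\<lambda>r. of_real (h r) * \<phi> r) \<in> borel_measurable N"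
    by measurable
qed

lemma integrable_stieltjes:
  assumes "z \<in> cut_plane"
  shows "integrable N (\<lambda>r. complex_of_real (h r) / (z + complex_of_real r))"
proof -
  obtain d where d: "d > 0"
    "\<And>w r. norm (w - z) < d \<Longrightarrow> r \<ge> 0 \<Longrightarrow> d \<le> norm (w + complex_of_real r)"
    using cut_plane_uniformly_away[OF assms] by metis
  have "norm (inverse (z + complex_of_real r)) \<le> inverse d" if "r \<ge> 0" for r
    using d(1) d(2)[of z r] that by (simp add: norm_inverse le_imp_inverse_le)
  then show ?thesis
    using integrable_bounded_weight[of "\<lambda>r. inverse (z + complex_of_real r)" "inverse d"]
    by (simp add: divide_inverse)
qed

text \<open>The difference quotient minus the candidate derivative is exactly (w - z) times the
  integral of h(r) / ((w + r)(z + r)^2), and that integral is bounded by a constant \<open>K\<close>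
  independent of w near z. The error is therefore O(|w - z|).\<close>

lemma stieltjes_has_field_derivative:
  assumes z: "z \<in> cut_plane"
  shows "(stieltjes has_field_derivative
           - (\<integral>r. complex_of_real (h r) / (z + complex_of_real r)\<^sup>2 \<partial>N)) (at z)"
proof -
  obtain d where d: "d > 0"
    "\<And>w r. norm (w - z) < d \<Longrightarrow> r \<ge> 0 \<Longrightarrow> d \<le> norm (w + complex_of_real r)"
    using cut_plane_uniformly_away[OF z] by metis
  obtain e where e: "e > 0" "ball z e \<subseteq> cut_plane"
    using open_cut_plane z openE by blast
  define D where "D = (\<integral>r. complex_of_real (h r) / (z + complex_of_real r)\<^sup>2 \<partial>N)"
  define K where "K = C * inverse d ^ 3 * measure N (space N)"
  have bound: "norm ((stieltjes w - stieltjes z) / (w - z) - - D) \<le> norm (w - z) * K"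
    if w: "norm (w - z) < d" "norm (w - z) < e" "w \<noteq> z" for w
  proof -
    have wc: "w \<in> cut_plane"
      using e(2) w by (auto simp: dist_norm norm_minus_commute)
    have inv_le: "norm (inverse (v + complex_of_real r)) \<le> inverse d"
      if "v = w \<or> v = z" "r \<ge> 0" for v r
      using that d w by (auto simp: norm_inverse intro!: le_imp_inverse_le)
    have nz: "w + complex_of_real r \<noteq> 0" "z + complex_of_real r \<noteq> 0" if "r \<ge> 0" for r
      using d(1) d(2)[of w r] d(2)[of z r] w that by auto
    have sq: "norm ((inverse (z + complex_of_real r))\<^sup>2) \<le> (inverse d)\<^sup>2" if "r \<ge> 0" for r
      using inv_le[of z r] that unfolding norm_power by (intro power_mono) auto
    have iD: "integrable N (\<lambda>r. complex_of_real (h r) / (z + complex_of_real r)\<^sup>2)"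
      using integrable_bounded_weight[of "\<lambda>r. (inverse (z + complex_of_real r))\<^sup>2" "(inverse d)\<^sup>2"] sq
      by (simp add: divide_inverse power_inverse)
    let ?g = "\<lambda>r. complex_of_real (h r) * (inverse (w + complex_of_real r) *
                   (inverse (z + complex_of_real r))\<^sup>2)"
    have gle: "norm (inverse (w + complex_of_real r) * (inverse (z + complex_of_real r))\<^sup>2)
                 \<le> inverse d ^ 3" if "r \<ge> 0" for r
    proof -
      have "norm (inverse (w + complex_of_real r)) * norm ((inverse (z + complex_of_real r))\<^sup>2)
              \<le> inverse d * (inverse d)\<^sup>2"
        using that d(1) by (intro mult_mono inv_le sq) auto
      then show ?thesis by (simp add: norm_mult power3_eq_cube power2_eq_square)
    qed
    have ig: "integrable N ?g"
      using gle by (intro integrable_bounded_weight) auto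
    have "(stieltjes w - stieltjes z) / (w - z) - - D =
        (\<integral>r. (complex_of_real (h r) / (w + complex_of_real r)
              - complex_of_real (h r) / (z + complex_of_real r)) / (w - z)
              + complex_of_real (h r) / (z + complex_of_real r)\<^sup>2 \<partial>N)"
      using integrable_stieltjes[OF wc] integrable_stieltjes[OF z] iD
      unfolding stieltjes_def D_def by simp
    also have "\<dots> = (\<integral>r. (w - z) * ?g r \<partial>N)"
    proof (rule integral_cong_AE)
      show "AE r in N. (complex_of_real (h r) / (w + complex_of_real r)
              - complex_of_real (h r) / (z + complex_of_real r)) / (w - z)
              + complex_of_real (h r) / (z + complex_of_real r)\<^sup>2 = (w - z) * ?g r"
        using r_nonneg
      proof eventually_elim
        fix r :: real assume "0 \<le> r"
        \<comment> \<open>With a = w + r and b = z + r, the quotient is -H/(ab), and 1/b^2 - 1/(ab)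
          = (a - b)/(ab^2).\<close>
        have gen: "(H / a - H / b) / (a - b) + H / b\<^sup>2 = (a - b) * (H * (inverse a * (inverse b)\<^sup>2))"
          if "a \<noteq> 0" "b \<noteq> 0" "a \<noteq> b" for a b H :: complex
          using that by (simp add: field_simps power2_eq_square)
        show "(complex_of_real (h r) / (w + complex_of_real r)
              - complex_of_real (h r) / (z + complex_of_real r)) / (w - z)
              + complex_of_real (h r) / (z + complex_of_real r)\<^sup>2 = (w - z) * ?g r"
          using gen[OF nz(1) nz(2), of r r "complex_of_real (h r)"] \<open>0 \<le> r\<close> w(3) by simp
      qed
    qed measurable
    finally have eq: "(stieltjes w - stieltjes z) / (w - z) - - D = (w - z) * (\<integral>r. ?g r \<partial>N)"
      by simp
    have "norm (\<integral>r. ?g r \<partial>N) \<le> (\<integral>r. norm (?g r) \<partial>N)"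
      by (rule integral_norm_bound)
    also have "\<dots> \<le> (\<integral>r. C * inverse d ^ 3 \<partial>N)"
    proof (rule integral_mono_AE)
      show "AE r in N. norm (?g r) \<le> C * inverse d ^ 3"
        using r_nonneg h_bound
      proof eventually_elim
        fix r assume r: "0 \<le> r" "\<bar>h r\<bar> \<le> C"
        show "norm (?g r) \<le> C * inverse d ^ 3"
          unfolding norm_mult[of "complex_of_real (h r)"]
          using r gle[OF r(1)] by (intro mult_mono) auto
      qed
    qed (use ig in auto)
    also have "\<dots> = K"
      by (simp add: K_def mult_ac)
    finally show ?thesis
      unfolding eq norm_mult by (rule mult_left_mono) simp
  qed
  have "((\<lambda>w. (stieltjes w - stieltjes z) / (w - z) - - D) \<longlongrightarrow> 0) (at z)"
  proof (rule Lim_null_comparison)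
    show "\<forall>\<^sub>F w in at z. norm ((stieltjes w - stieltjes z) / (w - z) - - D) \<le> norm (w - z) * K"
      unfolding eventually_at
      using bound d(1) e(1) by (intro exI[of _ "min d e"]) (auto simp: dist_norm)
    show "((\<lambda>w. norm (w - z) * K) \<longlongrightarrow> 0) (at z)"
      by (auto intro!: tendsto_eq_intros)
  qed
  then show ?thesis
    unfolding has_field_derivative_iff D_def[symmetric] by (rule LIM_zero_cancel)
qed

lemma stieltjes_holomorphic: "stieltjes holomorphic_on cut_plane"
  using stieltjes_has_field_derivative open_cut_plane
  by (auto simp: holomorphic_on_open)

end

section \<open>Sign and branch estimates for positive densities with an atom at 0\<close>

locale positive_stieltjes_density = stieltjes_density +
  assumes h_nonneg: "AE r in N. 0 \<le> h r"
    and zero_meas [measurable]: "{0} \<in> sets N"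
    and zero_atom: "measure N {0} * h 0 > 0"
begin

text \<open>The integrand is nonnegative, so all of it except the point 0 may be discarded. Every
  strict inequality below comes from this bound.\<close>

lemma atom_le_integral:
  assumes i: "integrable N (\<lambda>r. h r * \<phi> r)" and \<phi>: "\<And>r. r \<ge> 0 \<Longrightarrow> 0 \<le> \<phi> r"
  shows "measure N {0} * h 0 * \<phi> 0 \<le> (\<integral>r. h r * \<phi> r \<partial>N)"
proof -
  have "(\<integral>r. indicator {0} r * (h 0 * \<phi> 0) \<partial>N) \<le> (\<integral>r. h r * \<phi> r \<partial>N)"
  proof (rule integral_mono_AE)
    show "AE r in N. indicator {0} r * (h 0 * \<phi> 0) \<le> h r * \<phi> r"
      using r_nonneg h_nonneg by eventually_elim (auto simp: indicator_def \<phi>)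
    show "integrable N (\<lambda>r. indicator {0} r * (h 0 * \<phi> 0))"
      using emeasure_finite[of "{0}"]
      by (intro integrable_mult_left integrable_real_indicator) (auto simp flip: top.not_eq_extremum)
  qed (rule i)
  then show ?thesis by (simp add: mult_ac)
qed

lemma stieltjes_of_real:
  assumes "p > 0"
  shows "stieltjes (complex_of_real p) = complex_of_real (\<integral>r. h r / (p + r) \<partial>N)"
  by (simp add: stieltjes_def flip: of_real_add of_real_divide)

text \<open>At r = 0 the kernel p/(p + r) equals 1, which makes the lower bound independent of
  p.\<close>

lemma atom_le_stieltjes_real:
  assumes "p > 0"
  shows "measure N {0} * h 0 \<le> p * (\<integral>r. h r / (p + r) \<partial>N)"
proof -
  have "integrable N (\<lambda>r. h r * inverse (p + r))"
    using integrable_bounded_weight[of "\<lambda>r. inverse (p + r)" "inverse p"] assms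
    by (simp add: le_imp_inverse_le)
  from atom_le_integral[OF this] assms
  have "measure N {0} * h 0 / p \<le> (\<integral>r. h r / (p + r) \<partial>N)"
    by (simp add: divide_inverse)
  then have "p * (measure N {0} * h 0 / p) \<le> p * (\<integral>r. h r / (p + r) \<partial>N)"
    using assms by (intro mult_left_mono) auto
  then show ?thesis using assms by simp
qed

text \<open>Im (1/(z + r)) = -Im z / |z + r|^2. The factor Im z treats both half-planes together,
  and the atom makes the inequality strict.\<close>

lemma Im_stieltjes_sign:
  assumes z: "Im z \<noteq> 0"
  shows "Im z * Im (stieltjes z) < 0"
proof -
  have zc: "z \<in> cut_plane" using z unfolding mem_cut_plane_iff by simp
  have nz: "z + complex_of_real r \<noteq> 0" for r using z by (auto simp: complex_eq_iff)
  let ?\<phi> = "\<lambda>r. (Im z)\<^sup>2 / (norm (z + complex_of_real r))\<^sup>2"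
  have eq: "- Im z * Im (complex_of_real (h r) / (z + complex_of_real r)) = h r * ?\<phi> r" for r
    unfolding cmod_power2 by (simp add: Im_divide power2_eq_square)
  have "integrable N (\<lambda>r. - Im z * Im (complex_of_real (h r) / (z + complex_of_real r)))"
    using integrable_stieltjes[OF zc] by (intro integrable_mult_right integrable_Im)
  then have "integrable N (\<lambda>r. h r * ?\<phi> r)"
    unfolding eq .
  from atom_le_integral[OF this] have "measure N {0} * h 0 * ?\<phi> 0 \<le> (\<integral>r. h r * ?\<phi> r \<partial>N)"
    by simp
  also have "\<dots> = - Im z * Im (stieltjes z)"
    using integrable_stieltjes[OF zc] unfolding stieltjes_def eq[symmetric]
    by (simp add: integral_Im[symmetric] del: integral_Im)
  finally have "measure N {0} * h 0 * ?\<phi> 0 \<le> - Im z * Im (stieltjes z)" .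
  moreover have "measure N {0} * h 0 * ?\<phi> 0 > 0"
    using zero_atom z nz[of 0] by (intro mult_pos_pos[OF zero_atom] divide_pos_pos) auto
  ultimately show ?thesis by linarith
qed

text \<open>Im (z/(z + r)) = r Im z / |z + r|^2 with r \<ge> 0. The atom contributes nothing here,
  so the inequality is only weak.\<close>

lemma Im_mult_stieltjes_sign:
  assumes z: "Im z \<noteq> 0"
  shows "0 \<le> Im z * Im (z * stieltjes z)"
proof -
  have zc: "z \<in> cut_plane" using z unfolding mem_cut_plane_iff by simp
  have i: "integrable N (\<lambda>r. z * (complex_of_real (h r) / (z + complex_of_real r)))"
    using integrable_stieltjes[OF zc] by (rule integrable_mult_right)
  have eq: "Im z * Im (z * (complex_of_real (h r) / (z + complex_of_real r)))
      = h r * (r * (Im z)\<^sup>2 / (norm (z + complex_of_real r))\<^sup>2)" for r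
    unfolding cmod_power2
    by (simp add: Im_divide Re_divide power2_eq_square add_divide_distrib
        diff_divide_distrib algebra_simps)
  have "Im z * Im (z * stieltjes z) =
      (\<integral>r. Im z * Im (z * (complex_of_real (h r) / (z + complex_of_real r))) \<partial>N)"
    unfolding stieltjes_def integral_mult_right_zero[symmetric] integral_Im[OF i, symmetric] by simp
  also have "\<dots> \<ge> 0"
  proof (rule integral_nonneg_AE)
    show "AE r in N. 0 \<le> Im z * Im (z * (complex_of_real (h r) / (z + complex_of_real r)))"
      using r_nonneg h_nonneg unfolding eq by eventually_elim simp
  qed
  finally show ?thesis .
qed

lemma mult_stieltjes_in_cut_plane:
  assumes z: "z \<in> cut_plane"
  shows "z * stieltjes z \<in> cut_plane"
proof (cases "Im z = 0")
  case True
  then have p: "z = complex_of_real (Re z)" "Re z > 0"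
    using z unfolding mem_cut_plane_iff by (auto simp: complex_eq_iff)
  have "Re z * (\<integral>r. h r / (Re z + r) \<partial>N) > 0"
    using atom_le_stieltjes_real[OF p(2)] zero_atom by linarith
  then show ?thesis
    unfolding mem_cut_plane_iff using stieltjes_of_real[OF p(2)] p by simp
next
  case False
  define m where "m = stieltjes z"
  have 1: "Im z * Im m < 0" using Im_stieltjes_sign[OF False] by (simp add: m_def)
  have "Re (z * m) > 0" if "Im (z * m) = 0"
  proof -
    have e: "Re z * Im m = - (Im z * Re m)" using that by simp
    \<comment> \<open>The factor (Im z)^2 produces the product Im z Re m, which the vanishing of Im
      (zm) replaces by -Re z Im m without a division.\<close>
    have "(Im z)\<^sup>2 * Re (z * m) = Im z * Re z * (Im z * Re m) - (Im z)\<^sup>2 * (Im z * Im m)"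
      by (simp add: power2_eq_square algebra_simps)
    also have "\<dots> = - (Im z * Im m) * ((Re z)\<^sup>2 + (Im z)\<^sup>2)"
    proof -
      have "Im z * Re m = - (Re z * Im m)" using e by simp
      then show ?thesis by (simp add: power2_eq_square algebra_simps)
    qed
    also have "\<dots> > 0"
      using 1 False by (intro mult_pos_pos) (auto intro: add_nonneg_pos)
    finally show ?thesis by (simp add: zero_less_mult_iff)
  qed
  then show ?thesis unfolding mem_cut_plane_iff m_def by simp
qed

text \<open>Where \<open>Im z > 0\<close>, the argument of \<open>z * stieltjes z\<close> lies between \<open>0\<close> and \<open>arg z\<close>,
  so dividing \<open>z\<close> by its square root leaves an argument between \<open>arg z / 2\<close> and \<open>arg z\<close>.\<close>
lemma Im_divide_csqrt_sign:
  "0 \<le> Im z * Im (z / csqrt (z * stieltjes z))"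
proof (cases "Im z = 0")
  case False
  then have zc: "z \<in> cut_plane" unfolding mem_cut_plane_iff by simp
  define u where "u = csqrt (z * stieltjes z)"
  have u2: "u\<^sup>2 = z * stieltjes z" by (simp add: u_def)
  define a b x y where "a = Re u" "b = Im u" "x = Re z" "y = Im z"
  note defs = this
  have nz: "z * stieltjes z \<noteq> 0"
    using mult_stieltjes_in_cut_plane[OF zc] unfolding mem_cut_plane_iff by auto
  then have "u \<noteq> 0" by (simp add: u_def)
  have "z * stieltjes z \<notin> \<real>\<^sub>\<le>\<^sub>0"
    using mult_stieltjes_in_cut_plane[OF zc] unfolding cut_plane_eq_nonpos_Reals by blast
  \<comment> \<open>The principal root has Re u \<ge> 0, and Re u = 0 would put u^2 on the
    cut.\<close>
  then have a: "a > 0"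
    using Re_csqrt[of "z * stieltjes z"] u2 unfolding defs u_def[symmetric]
    by (smt (verit) complex_nonpos_Reals_iff Im_power2 Re_power2 mult_eq_0_iff zero_le_power2 zero_power2)
  have 1: "0 \<le> y * b"
  proof -
    have "0 \<le> y * (2 * a * b)"
      using Im_mult_stieltjes_sign[OF False] unfolding u2[symmetric] Im_power2 defs .
    then have "0 \<le> a * (y * b)" by (simp add: mult_ac)
    then show ?thesis using a by (simp add: zero_le_mult_iff)
  qed
  \<comment> \<open>Since u^2 = zm, multiplying by the conjugate of z gives |z|^2 m, whose imaginary
    part has a known strict sign.\<close>
  have 2: "y * (2 * a * b * x - (a\<^sup>2 - b\<^sup>2) * y) < 0"
  proof -
    have "Im (u\<^sup>2 * cnj z) = Im (stieltjes z) * (norm z)\<^sup>2"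
      unfolding u2 cmod_power2 by (simp add: power2_eq_square algebra_simps)
    moreover have "Im (u\<^sup>2 * cnj z) = 2 * a * b * x - (a\<^sup>2 - b\<^sup>2) * y"
      by (simp add: defs Re_power2 Im_power2 power2_eq_square algebra_simps)
    moreover have "y * Im (stieltjes z) * (norm z)\<^sup>2 < 0"
      using Im_stieltjes_sign[OF False] False unfolding defs
      by (intro mult_neg_pos[OF Im_stieltjes_sign[OF False]]) (auto simp: complex_eq_iff)
    ultimately show ?thesis by (simp add: mult.assoc)
  qed
  \<comment> \<open>Up to the factor 1/|u|^2, y a - x b is Im (z/u). If xyb is negative the claim is
    immediate; otherwise dropping b^2 y^2 from \<open>2\<close> leaves 2xyb < a y^2, more than
    enough.\<close>
  have "0 \<le> y * (y * a - x * b)"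
  proof (cases "0 \<le> x * (y * b)")
    case True
    have "a * (2 * (x * (y * b)) - a * y\<^sup>2) \<le> y * (2 * a * b * x - (a\<^sup>2 - b\<^sup>2) * y)"
      using mult_nonneg_nonneg[of "b\<^sup>2" "y\<^sup>2"] by (simp add: algebra_simps power2_eq_square)
    then have "a * (2 * (x * (y * b)) - a * y\<^sup>2) < 0" using 2 by linarith
    then have "2 * (x * (y * b)) - a * y\<^sup>2 < 0"
      using a by (simp add: mult_less_0_iff)
    then show ?thesis using True by (simp add: algebra_simps power2_eq_square)
  next
    case f: False
    have "0 \<le> a * y\<^sup>2" using a by simp
    then show ?thesis using f by (simp add: algebra_simps power2_eq_square)
  qed
  then have "0 \<le> y * (y * a - x * b) / (a\<^sup>2 + b\<^sup>2)" by simp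
  also have "\<dots> = Im z * Im (z / u)"
    by (simp add: Im_divide defs)
  finally show ?thesis by (simp add: u_def)
qed simp

lemma complete_bernstein_divide_sqrt:
  assumes "c \<ge> 0"
  shows "complete_bernstein (\<lambda>p. if p > 0 then c * p / sqrt (p * (\<integral>r. h r / (p + r) \<partial>N)) else 0)"
    (is "complete_bernstein ?g")
  unfolding complete_bernstein_def
proof (intro conjI)
  define g where "g = ?g"
  define lam where "lam p = p * (\<integral>r. h r / (p + r) \<partial>N)" for p
  define l where "l = measure N {0} * h 0"
  have lam: "l \<le> lam p" "lam p > 0" if "p > 0" for p
    using atom_le_stieltjes_real[OF that] zero_atom unfolding l_def lam_def by linarith+
  have g_eq: "g p = (if p > 0 then c * p / sqrt (lam p) else 0)" for p
    by (simp add: g_def lam_def)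
  have "0 \<le> g x" for x
    using lam(2)[of x] assms by (auto simp: g_eq intro!: divide_nonneg_nonneg)
  then show "\<forall>x\<ge>0. 0 \<le> ?g x" unfolding g_def by blast
  \<comment> \<open>The bound \<open>l\<close> for \<open>lam\<close> does not depend on p, so g is
    squeezed by a linear function.\<close>
  have "(g \<longlongrightarrow> 0) (at_right 0)"
  proof (rule Lim_null_comparison)
    have "norm (g p) \<le> c * p / sqrt l" if "p > 0" for p
    proof -
      have "norm (g p) = c * p / sqrt (lam p)"
        using that assms lam(2)[OF that] by (simp add: g_eq abs_mult)
      also have "\<dots> \<le> c * p / sqrt l"
        using lam(1)[OF that] that assms zero_atom
        by (intro divide_left_mono mult_nonneg_nonneg mult_pos_pos) (auto simp: l_def)
      finally show ?thesis .
    qed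
    then show "\<forall>\<^sub>F p in at_right 0. norm (g p) \<le> c * p / sqrt l"
      by (intro eventually_at_rightI[of 0 1]) auto
    show "((\<lambda>p. c * p / sqrt l) \<longlongrightarrow> 0) (at_right 0)"
      using zero_atom by (auto intro!: tendsto_eq_intros simp: l_def)
  qed
  then show "continuous (at_right 0) ?g"
    by (simp add: continuous_within g_def)
  define F where "F z = complex_of_real c * (z / csqrt (z * stieltjes z))" for z
  have "F holomorphic_on cut_plane"
    unfolding F_def
  proof (intro holomorphic_intros stieltjes_holomorphic)
    fix z assume "z \<in> cut_plane"
    from mult_stieltjes_in_cut_plane[OF this] show "z * stieltjes z \<notin> \<real>\<^sub>\<le>\<^sub>0"
      unfolding cut_plane_eq_nonpos_Reals by simp
    then show "csqrt (z * stieltjes z) \<noteq> 0" by auto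
  qed
  moreover have "F (complex_of_real x) = complex_of_real (g x)" if "x > 0" for x
  proof -
    have "complex_of_real x * stieltjes (complex_of_real x) = complex_of_real (lam x)"
      using stieltjes_of_real[OF that] by (simp add: lam_def)
    moreover have "csqrt (complex_of_real (lam x)) = complex_of_real (sqrt (lam x))"
      using lam(2)[OF that] by simp
    ultimately show ?thesis
      using that by (simp add: F_def g_eq)
  qed
  moreover have "0 \<le> Im z * Im (F z)" for z
  proof -
    have "Im (complex_of_real c * w) = c * Im w" for w by simp
    then have "Im (F z) = c * Im (z / csqrt (z * stieltjes z))"
      unfolding F_def .
    then have "Im z * Im (F z) = c * (Im z * Im (z / csqrt (z * stieltjes z)))"
      by (metis mult.left_commute)
    then show ?thesis
      by (metis Im_divide_csqrt_sign assms mult_nonneg_nonneg)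
  qed
  ultimately show "\<exists>F. F holomorphic_on cut_plane \<and>
      (\<forall>x>0. F (complex_of_real x) = complex_of_real (?g x)) \<and>
      (\<forall>z\<in>cut_plane. 0 \<le> Im z * Im (F z))"
    unfolding g_def by (intro exI[of _ F]) simp
qed

end

section \<open>Principal square roots of positive definite matrices\<close>

text \<open>A maximizer x of the Rayleigh quotient on the unit sphere of \<open>V\<close> is an
  eigenvector: with c the maximum, the form of B = c - T is nonnegative on \<open>V\<close> and
  vanishes at x, which forces Bx = 0. An invariant subspace is allowed so that the lemma applies to
  orthogonal complements.\<close>

lemma self_adjoint_eigenvector_in_invariant_subspace:
  fixes T :: "'a::euclidean_space \<Rightarrow> 'a"
  assumes lin: "linear T" and adj: "\<And>x y. T x \<bullet> y = x \<bullet> T y"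
    and V: "subspace V" and inv: "\<And>x. x \<in> V \<Longrightarrow> T x \<in> V"
    and ne: "v \<in> V" "v \<noteq> 0"
  obtains x where "x \<in> V" "norm x = 1" "T x = (x \<bullet> T x) *\<^sub>R x"
proof -
  let ?K = "V \<inter> sphere 0 1"
  have "compact ?K"
    by (metis V closed_subspace compact_sphere closed_Int_compact)
  moreover have "v /\<^sub>R norm v \<in> ?K"
    using ne V by (auto simp: subspace_scale)
  moreover have "continuous_on ?K (\<lambda>x. x \<bullet> T x)"
    using lin by (intro continuous_intros linear_continuous_on) (simp add: linear_conv_bounded_linear)
  ultimately obtain x where x: "x \<in> ?K" and max: "\<And>y. y \<in> ?K \<Longrightarrow> y \<bullet> T y \<le> x \<bullet> T x"
    using continuous_attains_sup[of ?K "\<lambda>x. x \<bullet> T x"] by blast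
  define c where "c = x \<bullet> T x"
  define B where "B y = c *\<^sub>R y - T y" for y
  have linB: "linear B"
    unfolding B_def using lin by (intro linear_compose_sub linear_scale_self) auto
  have Bnonneg: "y \<bullet> B y \<ge> 0" if "y \<in> V" for y
  proof (cases "y = 0")
    case False
    have "y /\<^sub>R norm y \<in> ?K"
      using that False V by (auto simp: subspace_scale)
    then have "(y /\<^sub>R norm y) \<bullet> T (y /\<^sub>R norm y) \<le> c"
      using max c_def by blast
    then have "(y \<bullet> T y) / (norm y)\<^sup>2 \<le> c"
      by (simp add: linear_scale[OF lin] power2_eq_square divide_simps)
    then have "y \<bullet> T y \<le> c * (y \<bullet> y)"
      using False by (simp add: divide_simps power2_norm_eq_inner split: if_splits)
    then show ?thesis
      by (simp add: B_def inner_diff_right)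
  qed auto
  have xx: "x \<bullet> x = 1"
    using x by (simp add: norm_eq_1)
  have xBx: "x \<bullet> B x = 0"
    by (simp add: B_def inner_diff_right c_def xx)
  define w where "w = B x"
  have wV: "w \<in> V"
    using x V inv by (simp add: w_def B_def subspace_diff subspace_scale)
  have Badj: "B y \<bullet> z = y \<bullet> B z" for y z
    by (simp add: B_def inner_diff_left inner_diff_right adj)
  have quad: "0 \<le> t\<^sup>2 * (w \<bullet> B w) - 2 * t * (w \<bullet> w)" for t
  proof -
    have "0 \<le> (x - t *\<^sub>R w) \<bullet> B (x - t *\<^sub>R w)"
      using x wV V by (intro Bnonneg) (auto simp: subspace_diff subspace_scale)
    also have "\<dots> = t\<^sup>2 * (w \<bullet> B w) - 2 * t * (w \<bullet> w)"
      using xBx Badj[of x w] unfolding w_def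
      by (simp add: linear_diff[OF linB] linear_scale[OF linB] inner_diff_left inner_diff_right
          power2_eq_square algebra_simps inner_commute)
    finally show ?thesis .
  qed
  have "w = 0"
  proof (rule ccontr)
    assume "w \<noteq> 0"
    then have w: "w \<bullet> w > 0" by simp
    \<comment> \<open>Any t > 0 with t (w . Bw) < 2 (w . w) contradicts \<open>quad\<close>; the 1
      keeps the denominator positive.\<close>
    define t where "t = (w \<bullet> w) / (1 + w \<bullet> B w)"
    have d: "w \<bullet> B w \<ge> 0" by (rule Bnonneg[OF wV])
    have t: "t > 0" using w d by (simp add: t_def)
    have "t * (w \<bullet> B w) \<le> w \<bullet> w"
      using d w unfolding t_def by (simp add: divide_simps) 
    then have "t * (t * (w \<bullet> B w)) \<le> t * (w \<bullet> w)"
      using t by (intro mult_left_mono) auto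
    moreover have "t * (w \<bullet> w) > 0" using t w by simp
    ultimately show False
      using quad[of t] by (simp add: power2_eq_square algebra_simps)
  qed
  then have "T x = (x \<bullet> T x) *\<^sub>R x"
    by (simp add: w_def B_def c_def)
  with x that show thesis by auto
qed

text \<open>Among orthonormal sets of eigenvectors, whose size is bounded by the dimension, take a
  largest one. Its orthogonal complement is invariant because T is self-adjoint, so a nonzero
  complement would contain a further eigenvector.\<close>

lemma self_adjoint_orthonormal_eigenbasis:
  fixes T :: "'a::euclidean_space \<Rightarrow> 'a"
  assumes lin: "linear T" and adj: "\<And>x y. T x \<bullet> y = x \<bullet> T y"
  obtains B where "finite B" "pairwise orthogonal B" "\<And>b. b \<in> B \<Longrightarrow> norm b = 1"
    "\<And>b. b \<in> B \<Longrightarrow> T b = (b \<bullet> T b) *\<^sub>R b" "span B = UNIV"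
proof -
  define P where "P B \<longleftrightarrow> pairwise orthogonal B \<and> (\<forall>b\<in>B. norm b = 1 \<and> T b = (b \<bullet> T b) *\<^sub>R b)"
    for B
  have bound: "finite B \<and> card B \<le> DIM('a)" if "P B" for B
  proof -
    have "0 \<notin> B" "pairwise orthogonal B" using that by (auto simp: P_def)
    then show ?thesis
      using independent_bound[OF pairwise_orthogonal_independent] by blast
  qed
  have "P {}" by (simp add: P_def)
  moreover have "\<forall>B. P B \<longrightarrow> card B \<le> DIM('a)"
    using bound by blast
  ultimately obtain B where B: "P B" and max: "\<And>C. P C \<Longrightarrow> card C \<le> card B"
    using ex_has_greatest_nat[of P "{}" card "Suc DIM('a)"] le_imp_less_Suc by metis
  define V where "V = {x. \<forall>b\<in>B. b \<bullet> x = 0}"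
  have V: "subspace V"
    by (auto simp: V_def subspace_def inner_add_right)
  have inv: "T x \<in> V" if "x \<in> V" for x
  proof -
    have "b \<bullet> T x = 0" if "b \<in> B" for b
    proof -
      have Tb: "T b = (b \<bullet> T b) *\<^sub>R b" using B that by (auto simp: P_def)
      have "b \<bullet> T x = T b \<bullet> x" by (simp add: adj)
      also have "\<dots> = (b \<bullet> T b) * (b \<bullet> x)" by (subst Tb) simp
      finally show ?thesis using \<open>x \<in> V\<close> that by (simp add: V_def)
    qed
    then show ?thesis by (simp add: V_def)
  qed
  have "span B = UNIV"
  proof (rule ccontr)
    assume "span B \<noteq> UNIV"
    then have "span B \<subset> span UNIV" by auto
    then obtain v where v: "v \<noteq> 0" "\<And>y. y \<in> span B \<Longrightarrow> orthogonal v y"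
      using orthogonal_to_subspace_exists_gen[of B UNIV] by metis
    then have "v \<in> V"
      by (auto simp: V_def orthogonal_def span_base inner_commute)
    then obtain x where x: "x \<in> V" "norm x = 1" "T x = (x \<bullet> T x) *\<^sub>R x"
      using self_adjoint_eigenvector_in_invariant_subspace[OF lin adj V inv _ v(1)] by blast
    have "x \<notin> B"
      using x by (auto simp: V_def)
    have "P (insert x B)"
      using B x unfolding P_def V_def
      by (auto simp: pairwise_insert orthogonal_def inner_commute)
    then have "card (insert x B) \<le> card B" by (rule max)
    then show False using \<open>x \<notin> B\<close> bound[OF B] by simp
  qed
  with B bound that show thesis unfolding P_def by blast
qed

section \<open>Complexified real matrices and their principal roots\<close>

definition cmat :: "real^'n^'m \<Rightarrow> complex^'n^'m" where
  "cmat A = (\<chi> i j. complex_of_real (A$i$j))"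

lemma cmat_mult: "cmat A ** cmat B = cmat (A ** B)"
  by (simp add: cmat_def matrix_matrix_mult_def vec_eq_iff)

lemma cmat_mult_cvec: "cmat A *v cvec x = cvec (A *v x)"
  by (simp add: cmat_def cvec_def matrix_vector_mult_def vec_eq_iff)

lemma cvec_scaleR: "cvec (a *\<^sub>R x) = complex_of_real a *s cvec x"
  by (simp add: cvec_def vec_eq_iff)

lemma cvec_eq_0_iff: "cvec x = 0 \<longleftrightarrow> x = 0"
  by (simp add: cvec_def vec_eq_iff)

text \<open>Split an eigenvector as x + iy. In x . Tx + y . Ty the terms with Im c cancel, leaving
  Re c (|x|^2 + |y|^2).\<close>

lemma eigenvalue_cmat_Re_pos:
  fixes T :: "real^'d^'d"
  assumes pos: "\<And>x. x \<noteq> 0 \<Longrightarrow> x \<bullet> (T *v x) > 0" and ev: "is_eigenvalue (cmat T) c"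
  shows "Re c > 0"
proof -
  obtain v where v: "v \<noteq> 0" "cmat T *v v = c *s v"
    using ev by (auto simp: is_eigenvalue_def)
  define x where "x = (\<chi> i. Re (v$i))"
  define y where "y = (\<chi> i. Im (v$i))"
  have comp: "(\<Sum>j\<in>UNIV. complex_of_real (T$i$j) * v$j) = c * v$i" for i
    using v(2) by (simp add: vec_eq_iff matrix_vector_mult_def cmat_def)
  have "(T *v x) $ i = Re c * x$i - Im c * y$i" for i
    using arg_cong[OF comp[of i], of Re] by (simp add: matrix_vector_mult_def x_def y_def)
  then have Tx: "T *v x = Re c *\<^sub>R x - Im c *\<^sub>R y"
    by (simp add: vec_eq_iff)
  have "(T *v y) $ i = Re c * y$i + Im c * x$i" for i
    using arg_cong[OF comp[of i], of Im] by (simp add: matrix_vector_mult_def x_def y_def)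
  then have Ty: "T *v y = Re c *\<^sub>R y + Im c *\<^sub>R x"
    by (simp add: vec_eq_iff)
  have eq: "x \<bullet> (T *v x) + y \<bullet> (T *v y) = Re c * (x \<bullet> x + y \<bullet> y)"
    unfolding Tx Ty by (simp add: inner_diff_right inner_add_right inner_commute algebra_simps)
  have "x \<noteq> 0 \<or> y \<noteq> 0"
    using v(1) by (auto simp: x_def y_def vec_eq_iff complex_eq_iff)
  moreover have "x \<bullet> (T *v x) \<ge> 0" "y \<bullet> (T *v y) \<ge> 0"
    using pos[of x] pos[of y] by (cases "x = 0"; cases "y = 0"; simp)+
  ultimately have "x \<bullet> (T *v x) + y \<bullet> (T *v y) > 0"
    using pos[of x] pos[of y] by (auto intro: add_pos_nonneg add_nonneg_pos)
  then have "Re c * (x \<bullet> x + y \<bullet> y) > 0"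
    by (simp add: eq)
  then show ?thesis
    by (meson add_nonneg_nonneg inner_ge_zero not_less zero_less_mult_pos2 mult_nonpos_nonneg)
qed

text \<open>Uniqueness is the Sylvester argument: if \<open>S\<^sup>2 = T\<^sup>2\<close> then \<open>X = S - T\<close> satisfies
  \<open>S X + X T = 0\<close>, so \<open>X\<close> maps a \<open>t\<close>-eigenvector of \<open>T\<close> to \<open>0\<close> or to a \<open>-t\<close>-eigenvector of \<open>S\<close>.\<close>
lemma principal_sqrtm_symmetric_pos_def:
  fixes A :: "real^'d^'d"
  assumes sym: "transpose A = A" and pos: "real_pos_def_mat A"
  defines "S \<equiv> principal_sqrtm (cmat A)"
  shows "S ** S = cmat A" and "\<And>c. is_eigenvalue S c \<Longrightarrow> Re c > 0"
proof -
  have adj: "(A *v x) \<bullet> y = x \<bullet> (A *v y)" for x y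
    by (metis dot_lmul_matrix sym transpose_matrix_vector)
  obtain B where B: "finite B" "pairwise orthogonal B" "\<And>b. b \<in> B \<Longrightarrow> norm b = 1"
    "\<And>b. b \<in> B \<Longrightarrow> A *v b = (b \<bullet> (A *v b)) *\<^sub>R b" "span B = UNIV"
    using self_adjoint_orthonormal_eigenbasis[of "(*v) A"] adj by auto
  have expand: "(\<Sum>b\<in>B. (x \<bullet> b) *\<^sub>R b) = x" for x
    using orthonormal_basis_expand[of B x] B by auto
  define s where "s b = sqrt (b \<bullet> (A *v b))" for b
  have nz: "b \<noteq> 0" if "b \<in> B" for b using B(3)[OF that] by auto
  have s_pos: "s b > 0" if "b \<in> B" for b
    using pos nz[OF that] by (simp add: s_def real_pos_def_mat_def)
  have s_sq: "s b * s b = b \<bullet> (A *v b)" if "b \<in> B" for b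
    using s_pos[OF that] by (simp add: s_def)
  \<comment> \<open>The spectral square root: same eigenvectors as \<open>A\<close>, eigenvalues
    replaced by their positive roots.\<close>
  define g where "g x = (\<Sum>b\<in>B. (s b * (x \<bullet> b)) *\<^sub>R b)" for x
  define T where "T = matrix g"
  have "linear g"
    unfolding g_def
    by (intro linearI) (simp_all add: inner_add_left algebra_simps sum.distrib scaleR_sum_right)
  then have Tg: "T *v x = g x" for x
    by (simp add: T_def matrix_works)
  have ortho: "c \<bullet> b = (if c = b then 1 else 0)" if "b \<in> B" "c \<in> B" for b c
    using B(2) B(3)[OF that(1)] that by (auto simp: pairwise_def orthogonal_def norm_eq_1)
  have Tb: "T *v b = s b *\<^sub>R b" if "b \<in> B" for b
  proof -
    have "g b = (\<Sum>c\<in>B. if c = b then s b *\<^sub>R b else 0)"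
      unfolding g_def using that by (intro sum.cong) (auto simp: ortho)
    then show ?thesis using B(1) that by (simp add: Tg)
  qed
  have TT: "T ** T = A"
  proof -
    have onB: "T *v (T *v b) = A *v b" if "b \<in> B" for b
      using that B(4)[OF that] by (simp add: Tb matrix_vector_mult_scaleR s_sq)
    have "(T ** T) *v x = A *v x" for x
    proof -
      have "T *v (T *v (\<Sum>b\<in>B. (x \<bullet> b) *\<^sub>R b)) = A *v (\<Sum>b\<in>B. (x \<bullet> b) *\<^sub>R b)"
        by (simp add: linear_sum[OF matrix_vector_mul_linear] matrix_vector_mult_scaleR onB)
      then show ?thesis by (simp add: expand matrix_vector_mul_assoc)
    qed
    then show ?thesis by (simp add: matrix_eq)
  qed
  have Tpos: "x \<bullet> (T *v x) > 0" if "x \<noteq> 0" for x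
  proof -
    have eq: "x \<bullet> (T *v x) = (\<Sum>b\<in>B. s b * (x \<bullet> b)\<^sup>2)"
      by (simp add: Tg g_def inner_sum_right power2_eq_square mult.assoc)
    have "\<exists>b\<in>B. x \<bullet> b \<noteq> 0"
      using expand[of x] that by (metis (no_types, lifting) scale_zero_left sum.neutral)
    then obtain b where "b \<in> B" "x \<bullet> b \<noteq> 0" by blast
    then show ?thesis
      unfolding eq using s_pos B(1)
      by (intro sum_pos2[of B b]) (auto simp: less_imp_le)
  qed
  let ?P = "\<lambda>S. S ** S = cmat A \<and> (\<forall>c. is_eigenvalue S c \<longrightarrow> Re c > 0)"
  have PT: "?P (cmat T)"
    using eigenvalue_cmat_Re_pos[OF Tpos] by (auto simp: cmat_mult TT)
  have "R = cmat T" if R: "?P R" for R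
  proof -
    define X where "X = R - cmat T"
    have Xb: "X *v cvec b = 0" if "b \<in> B" for b
    proof (rule ccontr)
      assume ne: "X *v cvec b \<noteq> 0"
      have Tcb: "cmat T *v cvec b = complex_of_real (s b) *s cvec b"
        using Tb[OF that] by (simp add: cmat_mult_cvec cvec_scaleR)
      have RR: "R *v (R *v cvec b) = cmat T *v (cmat T *v cvec b)"
        using R PT by (simp add: matrix_vector_mul_assoc)
      have "R *v (X *v cvec b) = R *v (R *v cvec b) - R *v (cmat T *v cvec b)"
        by (simp add: X_def matrix_vector_mult_diff_rdistrib matrix_vector_mult_diff_distrib)
      also have "\<dots> = complex_of_real (s b) *s (cmat T *v cvec b - R *v cvec b)"
        unfolding RR Tcb by (simp add: vector_scalar_commute vector_ssub_ldistrib Tcb)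
      also have "\<dots> = complex_of_real (- s b) *s (X *v cvec b)"
        by (simp add: X_def matrix_vector_mult_diff_rdistrib vec_eq_iff algebra_simps)
      finally have "is_eigenvalue R (complex_of_real (- s b))"
        using ne unfolding is_eigenvalue_def by blast
      then have "Re (complex_of_real (- s b)) > 0" using R by blast
      then show False using s_pos[OF that] by simp
    qed
    \<comment> \<open>Real vectors suffice, since the coordinate vectors that read off the columns
      of \<open>X\<close> are real.\<close>
    have "X *v v = 0" if "v = cvec x" for v x
    proof -
      have "cvec x = (\<Sum>b\<in>B. complex_of_real (x \<bullet> b) *s cvec b)"
        using arg_cong[OF expand[of x], of cvec, symmetric]
        by (simp add: cvec_def vec_eq_iff)
      then show ?thesis
        by (simp add: that vec.linear_sum[OF matrix_vector_mul_linear_gen] vector_scalar_commute Xb)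
    qed
    moreover have "axis i 1 = cvec (axis i 1)" for i :: 'd
      by (simp add: cvec_def axis_def vec_eq_iff)
    ultimately have "X *v axis i 1 = 0" for i by blast
    moreover have "(X *v axis i 1) $ j = X $ j $ i" for i j
      by (simp add: matrix_vector_mult_def axis_def if_distrib cong: if_cong)
    ultimately have "X = 0"
      by (simp add: vec_eq_iff)
    then show ?thesis by (simp add: X_def)
  qed
  then have "?P S"
    unfolding S_def principal_sqrtm_def by (rule theI[of ?P, OF PT])
  then show "S ** S = cmat A" "\<And>c. is_eigenvalue S c \<Longrightarrow> Re c > 0" by auto
qed

text \<open>Inverting gives S f = f/c, and squaring gives f . Af = 1/c^2. This leaves the sign of c
  open; Re (1/c) > 0, from the spectrum of S, decides it.\<close>

lemma inverse_principal_sqrtm_eigenvalue: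
  fixes A :: "real^'d^'d"
  assumes sym: "transpose A = A" and pos: "real_pos_def_mat A" and f: "norm f = 1"
    and ev: "matrix_inv (principal_sqrtm (cmat A)) *v cvec f = c *s cvec f"
  shows "c = complex_of_real (1 / sqrt (f \<bullet> (A *v f)))"
proof -
  define S where "S = principal_sqrtm (cmat A)"
  note S = principal_sqrtm_symmetric_pos_def[OF sym pos, folded S_def]
  \<comment> \<open>0 is not an eigenvalue of S, so \<open>matrix_inv S\<close> is a genuine
    inverse.\<close>
  have "\<forall>x. S *v x = 0 \<longrightarrow> x = 0"
  proof (intro allI impI, rule ccontr)
    fix x assume "S *v x = 0" "x \<noteq> 0"
    then have "is_eigenvalue S 0" unfolding is_eigenvalue_def by auto
    from S(2)[OF this] show False by simp
  qed
  then have "invertible S"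
    by (simp add: invertible_left_inverse matrix_left_invertible_ker)
  then have "S ** matrix_inv S = mat 1"
    unfolding invertible_def matrix_inv_def by (rule someI2_ex) blast
  then have "cvec f = S *v (matrix_inv S *v cvec f)"
    by (simp add: matrix_vector_mul_assoc)
  also have "\<dots> = c *s (S *v cvec f)"
    using ev by (simp add: S_def vector_scalar_commute)
  finally have eq: "cvec f = c *s (S *v cvec f)" .
  have "f \<noteq> 0" using f by auto
  then have f0: "cvec f \<noteq> 0" by (simp add: cvec_eq_0_iff)
  then have c: "c \<noteq> 0" using eq by auto
  have Sf: "S *v cvec f = inverse c *s cvec f"
    by (subst (2) eq) (use c in \<open>simp add: vec_eq_iff\<close>)
  then have re: "Re (inverse c) > 0"
    using S(2) f0 unfolding is_eigenvalue_def by blast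
  have "cmat A *v cvec f = S *v (S *v cvec f)"
    by (simp add: S(1) matrix_vector_mul_assoc)
  also have "\<dots> = (inverse c)\<^sup>2 *s cvec f"
    by (simp add: Sf vector_scalar_commute vec_eq_iff power2_eq_square)
  finally have "complex_of_real ((A *v f) $ i) = (inverse c)\<^sup>2 * complex_of_real (f $ i)" for i
    unfolding cmat_mult_cvec by (simp add: cvec_def vec_eq_iff)
  then have "complex_of_real (f \<bullet> (A *v f)) = (inverse c)\<^sup>2 * complex_of_real (f \<bullet> f)"
    by (simp add: inner_vec_def sum_distrib_left mult_ac)
  then have "complex_of_real (f \<bullet> (A *v f)) = (inverse c)\<^sup>2"
    using f by (simp add: norm_eq_1)
  then have "csqrt (complex_of_real (f \<bullet> (A *v f))) = inverse c"
    using re by (intro csqrt_unique) auto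
  moreover have "f \<bullet> (A *v f) > 0"
    using pos \<open>f \<noteq> 0\<close> by (simp add: real_pos_def_mat_def)
  ultimately have "inverse c = complex_of_real (sqrt (f \<bullet> (A *v f)))"
    by simp
  then show ?thesis
    by (metis inverse_inverse_eq inverse_eq_divide of_real_inverse)
qed

section \<open>Contractions of positive elements of \<open>W\<close>\<close>

lemma frob_add_left: "frob (E + F) G = frob E G + frob F G"
  by (simp add: frob_def algebra_simps sum.distrib)

lemma frob_add_right: "frob E (F + G) = frob E F + frob E G"
  by (simp add: frob_def algebra_simps sum.distrib)

lemma app4_add: "app4 X (E + F) = app4 X E + app4 X F"
  by (simp add: app4_def vec_eq_iff algebra_simps sum.distrib)

lemma app4_transpose:
  assumes "in_W X"
  shows "app4 X (transpose E) = app4 X E"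
proof -
  have "(\<Sum>k\<in>UNIV. \<Sum>l\<in>UNIV. X$i$j$k$l * E$l$k) = (\<Sum>k\<in>UNIV. \<Sum>l\<in>UNIV. X$i$j$k$l * E$k$l)" for i j
  proof (subst sum.swap, intro sum.cong refl)
    fix k l
    have "X$i$j$l$k = X$i$j$k$l" using assms unfolding in_W_def by blast
    then show "X$i$j$l$k * E$k$l = X$i$j$k$l * E$k$l" by simp
  qed
  then show ?thesis by (simp add: app4_def transpose_def)
qed

lemma frob_transpose_app4:
  assumes "in_W X"
  shows "frob (transpose E) (app4 X F) = frob E (app4 X F)"
proof -
  have sym: "app4 X F $ i $ j = app4 X F $ j $ i" for i j
  proof -
    have "X$i$j$k$l = X$j$i$k$l" for k l using assms unfolding in_W_def by blast
    then show ?thesis by (simp add: app4_def)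
  qed
  show ?thesis
    unfolding frob_def transpose_def by (subst sum.swap) (simp add: sym)
qed

lemma inner_contract:
  fixes X :: "real^'d^'d^'d^'d"
  shows "x \<bullet> (contract X n *v y) =
    (\<Sum>i\<in>UNIV. \<Sum>k\<in>UNIV. \<Sum>j\<in>UNIV. \<Sum>l\<in>UNIV. x$i * n$j * (n$l * y$k) * X$i$j$k$l)"
  by (simp add: inner_vec_def matrix_vector_mult_def contract_def sum_distrib_left
      sum_distrib_right mult_ac)

text \<open>The quadratic form of the contraction is that of X at the rank-one matrix x n^T.
  Positivity is given only on symmetric matrices, so this matrix is symmetrized; by the minor
  symmetries each of the four resulting terms is the same.\<close>

lemma contract_nonneg:
  assumes W: "in_W X" and psd: "W_psd X"
  shows "x \<bullet> (contract X n *v x) \<ge> 0"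
proof -
  define E where "E = (\<chi> i j. x$i * n$j)"
  have "symm_mat (E + transpose E)"
    by (simp add: symm_mat_def transpose_def)
  then have "0 \<le> frob (E + transpose E) (app4 X (E + transpose E))"
    using psd by (simp add: W_psd_def)
  also have "\<dots> = 4 * frob E (app4 X E)"
    unfolding app4_add app4_transpose[OF W] frob_add_left frob_add_right frob_transpose_app4[OF W]
    by simp
  finally have "0 \<le> frob E (app4 X E)" by simp
  also have "frob E (app4 X E) =
      (\<Sum>i\<in>UNIV. \<Sum>j\<in>UNIV. \<Sum>k\<in>UNIV. \<Sum>l\<in>UNIV. x$i * n$j * (n$l * x$k) * X$i$j$k$l)"
    by (simp add: frob_def app4_def E_def sum_distrib_left mult_ac)
  also have "\<dots> = x \<bullet> (contract X n *v x)"
    unfolding inner_contract by (intro sum.cong refl sum.swap)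
  finally show ?thesis .
qed

text \<open>Testing the norm bound on a symmetrized matrix unit isolates 2 X_ijkl, also when k = l.
  Entries of that test matrix are at most 2, giving the crude bound 4 d^2 for its squared norm; only
  uniformity in r matters.\<close>

lemma W_norm_le1_component_bound:
  fixes X :: "real^'d^'d^'d^'d"
  assumes W: "in_W X" and norm: "W_norm_le1 X"
  shows "\<bar>X$i$j$k$l\<bar> \<le> real CARD('d)"
proof -
  define D :: "real^'d^'d" where "D = (\<chi> a b. if a = k then (if b = l then 1 else 0) else 0)"
  define E where "E = D + transpose D"
  have sym: "symm_mat E" by (simp add: E_def symm_mat_def transpose_def)
  have "(\<Sum>b\<in>UNIV. X$i$j$a$b * D$a$b) = (if a = k then X$i$j$k$l else 0)" for a
    by (cases "a = k") (simp_all add: D_def if_distrib[where f = "(*) c" for c] cong: if_cong)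
  then have "app4 X D $ i $ j = X$i$j$k$l"
    by (simp add: app4_def)
  then have app: "app4 X E $ i $ j = 2 * X$i$j$k$l"
    by (simp add: E_def app4_add app4_transpose[OF W])
  have "(app4 X E $ i $ j)\<^sup>2 \<le> (\<Sum>b\<in>UNIV. (app4 X E $ i $ b)\<^sup>2)"
    by (rule member_le_sum) auto
  also have "\<dots> \<le> (\<Sum>a\<in>UNIV. \<Sum>b\<in>UNIV. (app4 X E $ a $ b)\<^sup>2)"
    by (rule member_le_sum) (auto intro: sum_nonneg)
  also have "\<dots> = frob (app4 X E) (app4 X E)"
    by (simp add: frob_def power2_eq_square)
  also have "\<dots> \<le> frob E E"
    using norm sym by (simp add: W_norm_le1_def)
  also have "\<dots> \<le> (\<Sum>a\<in>(UNIV::'d set). \<Sum>b\<in>(UNIV::'d set). 4)"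
    unfolding frob_def by (intro sum_mono) (simp add: E_def D_def transpose_def)
  also have "\<dots> = (2 * real CARD('d))\<^sup>2"
    by (simp add: power2_eq_square)
  finally have "(2 * X$i$j$k$l)\<^sup>2 \<le> (2 * real CARD('d))\<^sup>2" unfolding app .
  then have "\<bar>2 * X$i$j$k$l\<bar> \<le> \<bar>2 * real CARD('d)\<bar>"
    by (simp only: abs_le_square_iff)
  then show ?thesis by simp
qed

section \<open>From the tensor data to a scalar density\<close>

locale relaxation_data =
  fixes M :: "real measure" and H :: "real \<Rightarrow> real^'d^'d^'d^'d" and n :: "real^'d"
  assumes M_sets: "sets M = sets borel"
    and M_support: "emeasure M {..<0} = 0"
    and M_finite: "emeasure M (space M) < \<infinity>"
    and H_meas: "H \<in> borel_measurable (completion M)"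
    and H_W: "\<And>r. r \<ge> 0 \<Longrightarrow> in_W (H r)"
    and H_psd: "AE r in M. W_psd (H r)"
    and H_norm: "AE r in M. W_norm_le1 (H r)"
    and Ginf_pos: "real_pos_def_mat (contract (Ginf M H) n)"
begin

abbreviation "N \<equiv> completion M"

lemma finite_measure_N: "finite_measure N"
  using M_finite by (intro finite_measureI) (auto simp: less_top)

lemma AE_nonneg: "AE r in N. 0 \<le> r"
proof -
  have "{..<0} \<in> null_sets M"
    using M_support M_sets by (auto simp: null_sets_def)
  then have "AE r in M. 0 \<le> r"
    by (rule AE_I') auto
  then show ?thesis by (rule AE_completion)
qed

lemma component_measurable [measurable]: "(\<lambda>r. H r $ i $ j $ k $ l) \<in> borel_measurable N"
proof -
  have "(\<lambda>X :: real^'d^'d^'d^'d. X $ i $ j $ k $ l) \<in> borel_measurable borel"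
    by (intro borel_measurable_continuous_onI continuous_intros)
  then show ?thesis using measurable_compose[OF H_meas] by blast
qed

lemma ident_measurable [measurable]: "(\<lambda>r. r) \<in> borel_measurable N"
  using M_sets by (intro measurable_completion measurable_ident_sets)

lemma AE_component_bound: "AE r in N. \<bar>H r $ i $ j $ k $ l\<bar> \<le> real CARD('d)"
  using AE_nonneg AE_completion[OF H_norm]
  by eventually_elim (auto intro: W_norm_le1_component_bound H_W)

lemma integrable_component:
  assumes "p > 0"
  shows "integrable N (\<lambda>r. H r $ i $ j $ k $ l / (p + r))"
proof -
  interpret finite_measure N by (rule finite_measure_N)
  show ?thesis
  proof (rule integrable_const_bound)
    show "AE r in N. norm (H r $ i $ j $ k $ l / (p + r)) \<le> real CARD('d) / p"
      using AE_nonneg AE_component_bound[of i j k l]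
    proof eventually_elim
      fix r assume r: "0 \<le> r" "\<bar>H r $ i $ j $ k $ l\<bar> \<le> real CARD('d)"
      then have "\<bar>H r $ i $ j $ k $ l\<bar> / (p + r) \<le> real CARD('d) / p"
        using assms by (intro frac_le) auto
      then show "norm (H r $ i $ j $ k $ l / (p + r)) \<le> real CARD('d) / p"
        using r assms by simp
    qed
  qed measurable
qed

definition density :: "real^'d \<Rightarrow> real \<Rightarrow> real" where
  "density x r = x \<bullet> (contract (H r) n *v x)"

text \<open>The constant is the triangle inequality applied to the four-index sum with the
  componentwise bound; the atom condition is the standing assumption tested on x.\<close>

lemma positive_stieltjes_density_density:
  assumes x: "x \<noteq> 0"
  shows "positive_stieltjes_density N (density x)
    (\<Sum>i\<in>UNIV. \<Sum>k\<in>UNIV. \<Sum>j\<in>UNIV. \<Sum>l\<in>UNIV. \<bar>x$i * n$j * (n$l * x$k)\<bar> * real CARD('d))"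
    (is "positive_stieltjes_density _ _ ?C")
proof -
  interpret finite_measure N by (rule finite_measure_N)
  show ?thesis
  proof unfold_locales
    show "density x \<in> borel_measurable N"
      unfolding density_def inner_contract by measurable
    have "AE r in N. \<forall>i j k l. \<bar>H r $ i $ j $ k $ l\<bar> \<le> real CARD('d)"
      using AE_component_bound by (simp add: AE_all_countable)
    then show "AE r in N. \<bar>density x r\<bar> \<le> ?C"
    proof eventually_elim
      fix r assume r: "\<forall>i j k l. \<bar>H r $ i $ j $ k $ l\<bar> \<le> real CARD('d)"
      show "\<bar>density x r\<bar> \<le> ?C"
        unfolding density_def inner_contract
        by (intro order_trans[OF sum_abs] sum_mono)
          (simp only: abs_mult[of _ "H r $ _ $ _ $ _ $ _"], intro mult_left_mono r[rule_format] abs_ge_zero)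
    qed
    show "AE r in N. 0 \<le> density x r"
      using AE_nonneg AE_completion[OF H_psd]
      by eventually_elim (auto simp: density_def intro: contract_nonneg H_W)
    have "{0} \<in> sets M" by (simp add: M_sets)
    then show "{0} \<in> sets N" by simp
    have "x \<bullet> (contract (Ginf M H) n *v x) = measure M {0} * density x 0"
      by (simp add: density_def inner_contract Ginf_def sum_distrib_left mult_ac)
    moreover have "x \<bullet> (contract (Ginf M H) n *v x) > 0"
      using Ginf_pos x by (simp add: real_pos_def_mat_def)
    ultimately show "0 < measure N {0} * density x 0"
      using \<open>{0} \<in> sets M\<close> by simp
  qed (use AE_nonneg in auto)
qed

text \<open>A real-valued copy of Q at real arguments, to which the real spectral theorem
  applies.\<close>

definition Qreal :: "real \<Rightarrow> real^'d^'d^'d^'d" where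
  "Qreal p = (\<chi> i j k l. p * (\<integral>r. H r $ i $ j $ k $ l / (p + r) \<partial>N))"

lemma contract_Qfun_of_real:
  "contract (Qfun M H (complex_of_real p)) n = cmat (contract (Qreal p) n)"
  by (simp add: contract_def Qfun_def Qreal_def cmat_def vec_eq_iff
      flip: of_real_add of_real_divide)

lemma transpose_contract_Qreal: "transpose (contract (Qreal p) n) = contract (Qreal p) n"
proof -
  have "Qreal p $ i $ j $ k $ l = Qreal p $ k $ l $ i $ j" for i j k l
  proof -
    have "(\<integral>r. H r $ i $ j $ k $ l / (p + r) \<partial>N) = (\<integral>r. H r $ k $ l $ i $ j / (p + r) \<partial>N)"
    proof (rule integral_cong_AE)
      show "AE r in N. H r $ i $ j $ k $ l / (p + r) = H r $ k $ l $ i $ j / (p + r)"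
        using AE_nonneg
      proof eventually_elim
        fix r :: real assume "0 \<le> r"
        then have "H r $ i $ j $ k $ l = H r $ k $ l $ i $ j"
          using H_W unfolding in_W_def by blast
        then show "H r $ i $ j $ k $ l / (p + r) = H r $ k $ l $ i $ j / (p + r)" by simp
      qed
    qed measurable
    then show ?thesis by (simp add: Qreal_def)
  qed
  then have "contract (Qreal p) n $ k $ i = contract (Qreal p) n $ i $ k" for i k
    unfolding contract_def vec_lambda_beta by (subst sum.swap) (simp add: mult.commute)
  then show ?thesis by (simp add: transpose_def vec_eq_iff)
qed

lemma inner_contract_Qreal:
  assumes "p > 0"
  shows "x \<bullet> (contract (Qreal p) n *v x) = p * (\<integral>r. density x r / (p + r) \<partial>N)"
proof -
  have "(\<integral>r. density x r / (p + r) \<partial>N) =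
    (\<integral>r. (\<Sum>i\<in>UNIV. \<Sum>k\<in>UNIV. \<Sum>j\<in>UNIV. \<Sum>l\<in>UNIV.
       x$i * n$j * (n$l * x$k) * (H r $ i $ j $ k $ l / (p + r))) \<partial>N)"
    by (simp add: density_def inner_contract sum_divide_distrib)
  also have "\<dots> = (\<Sum>i\<in>UNIV. \<Sum>k\<in>UNIV. \<Sum>j\<in>UNIV. \<Sum>l\<in>UNIV.
       x$i * n$j * (n$l * x$k) * (\<integral>r. H r $ i $ j $ k $ l / (p + r) \<partial>N))"
    using integrable_component[OF assms]
    by (simp add: Bochner_Integration.integral_sum Bochner_Integration.integrable_sum
        del: times_divide_eq_right)
  finally show ?thesis
    unfolding inner_contract Qreal_def by (simp add: sum_distrib_left mult_ac)
qed

lemma contract_Qreal_pos_def: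
  assumes "p > 0"
  shows "real_pos_def_mat (contract (Qreal p) n)"
  unfolding real_pos_def_mat_def
proof (intro allI impI)
  fix x :: "real^'d" assume x: "x \<noteq> 0"
  interpret positive_stieltjes_density N "density x"
    "\<Sum>i\<in>UNIV. \<Sum>k\<in>UNIV. \<Sum>j\<in>UNIV. \<Sum>l\<in>UNIV. \<bar>x$i * n$j * (n$l * x$k)\<bar> * real CARD('d)"
    by (rule positive_stieltjes_density_density[OF x])
  show "0 < x \<bullet> (contract (Qreal p) n *v x)"
    using atom_le_stieltjes_real[OF assms] zero_atom
    unfolding inner_contract_Qreal[OF assms] by linarith
qed

lemma quadratic_form_Kfun:
  assumes p: "p > 0" and \<rho>: "\<rho> > 0" and f: "norm f = 1"
    and ev: "Kfun \<rho> M H n (complex_of_real p) *v cvec f = c *s cvec f"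
  shows "(\<Sum>i\<in>UNIV. \<Sum>k\<in>UNIV. complex_of_real (f$i * f$k) * Kfun \<rho> M H n (complex_of_real p) $ i $ k)
    = complex_of_real (sqrt \<rho> * p / sqrt (p * (\<integral>r. density f r / (p + r) \<partial>N)))"
proof -
  define A where "A = contract (Qreal p) n"
  define J where "J = matrix_inv (principal_sqrtm (cmat A))"
  define a where "a = complex_of_real (sqrt \<rho> * p)"
  have a: "a \<noteq> 0" using p \<rho> by (simp add: a_def)
  have K: "Kfun \<rho> M H n (complex_of_real p) $ i $ k = a * J $ i $ k" for i k
    using p by (simp add: Kfun_def a_def J_def A_def contract_Qfun_of_real)
  have "a * (J *v cvec f) $ i = (c *s cvec f) $ i" for i
    unfolding ev[symmetric] by (simp add: matrix_vector_mult_def K sum_distrib_left mult.assoc)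
  \<comment> \<open>K is the nonzero scalar \<open>a\<close> times the inverse root
    \<open>J\<close>, so the eigenvector passes to \<open>J\<close>.\<close>
  then have J: "J *v cvec f = (c / a) *s cvec f"
    using a by (simp add: vec_eq_iff field_simps)
  have "c / a = complex_of_real (1 / sqrt (f \<bullet> (A *v f)))"
    using transpose_contract_Qreal contract_Qreal_pos_def[OF p] f J unfolding A_def J_def
    by (rule inverse_principal_sqrtm_eigenvalue)
  then have c: "c = complex_of_real (sqrt \<rho> * p / sqrt (f \<bullet> (A *v f)))"
    using a by (simp add: a_def field_simps)
  have "(\<Sum>i\<in>UNIV. \<Sum>k\<in>UNIV. complex_of_real (f$i * f$k) * Kfun \<rho> M H n (complex_of_real p) $ i $ k)
    = (\<Sum>i\<in>UNIV. complex_of_real (f$i) * (Kfun \<rho> M H n (complex_of_real p) *v cvec f) $ i)"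
    by (simp add: matrix_vector_mult_def cvec_def sum_distrib_left mult_ac)
  also have "\<dots> = c * complex_of_real (f \<bullet> f)"
    unfolding ev by (simp add: cvec_def inner_vec_def sum_distrib_left mult_ac)
  also have "\<dots> = c" using f by (simp add: norm_eq_1)
  finally show ?thesis
    unfolding c A_def inner_contract_Qreal[OF p] .
qed

end

theorem mainTheorem9:
  fixes \<rho> :: real and M :: "real measure" and H :: "real \<Rightarrow> real^'d^'d^'d^'d"
    and n f :: "real^'d"
  assumes rho_pos: "\<rho> > 0"
    and M_sets: "sets M = sets borel"
    and M_support: "emeasure M {..<0} = 0"
    and M_finite: "emeasure M (space M) < \<infinity>"
    and M_nonzero: "emeasure M (space M) \<noteq> 0"
    and H_meas: "H \<in> borel_measurable (completion M)"
    and H_W: "\<forall>r\<ge>0. in_W (H r)"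
    and H_psd: "AE r in M. W_psd (H r)"
    and H_norm: "AE r in M. W_norm_le1 (H r)"
    and standing: "\<forall>m::real^'d. norm m = 1 \<longrightarrow> real_pos_def_mat (contract (Ginf M H) m)"
    and n_unit: "norm n = 1"
    and f_unit: "norm f = 1"
    and f_eig: "\<forall>p::real. p > 0 \<longrightarrow>
                  (\<exists>c. Kfun \<rho> M H n (complex_of_real p) *v cvec f = c *s cvec f)"
  shows "\<exists>g. complete_bernstein g \<and>
           (\<forall>p::real. p \<ge> 0 \<longrightarrow>
              (\<Sum>i\<in>UNIV. \<Sum>k\<in>UNIV. complex_of_real (f$i * f$k) *
                   Kfun \<rho> M H n (complex_of_real p) $ i $ k) = complex_of_real (g p))"
proof -
  interpret relaxation_data M H n
    using assms by unfold_locales auto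
  have "f \<noteq> 0" using f_unit by auto
  then interpret positive_stieltjes_density "completion M" "density f"
    "\<Sum>i\<in>UNIV. \<Sum>k\<in>UNIV. \<Sum>j\<in>UNIV. \<Sum>l\<in>UNIV. \<bar>f$i * n$j * (n$l * f$k)\<bar> * real CARD('d)"
    by (rule positive_stieltjes_density_density)
  \<comment> \<open>The value 0 at p = 0 matches the convention K_n(0) = 0.\<close>
  let ?g = "\<lambda>p. if p > 0
    then sqrt \<rho> * p / sqrt (p * (\<integral>r. density f r / (p + r) \<partial>completion M)) else 0"
  have "complete_bernstein ?g"
    using rho_pos by (intro complete_bernstein_divide_sqrt) simp
  moreover have "(\<Sum>i\<in>UNIV. \<Sum>k\<in>UNIV. complex_of_real (f$i * f$k) *
      Kfun \<rho> M H n (complex_of_real p) $ i $ k) = complex_of_real (?g p)" if "p \<ge> 0" for p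
  proof (cases "p = 0")
    case True
    then show ?thesis by (simp add: Kfun_def)
  next
    case False
    then have "p > 0" using that by simp
    then show ?thesis
      using f_eig quadratic_form_Kfun[OF _ rho_pos f_unit] by auto
  qed
  ultimately show ?thesis by blast
qed

end
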